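(* Let (P) and (R) be the optimization problems defined in the context, with projected feasible sets $\mathcal F_{P},\mathcal F_{R}\subseteq\{0,1\}^{n_u}$. Let (R$^+$) be problem (R) with the additional constraint $\|a-a^r\|_1\ge 1$ added for each $a^r\in\mathcal A$, where $$\mathcal A := \{a\in\{0,1\}^{n_u} \mid a\in \mathcal F_{R}\setminus\mathcal F_{P}\}.$$ Let $\mathcal P$ be the intersection of these constraints, $$\mathcal P := \{a\in\mathbb R^{n_u} \mid \|a-a^r\|_1\ge 1 \ \text{ for all } a^r\in\mathcal A\}.$$ Then $\mathcal P$ is a finite-dimensional convex polyhedron, and the projection of the feasible region of (R$^+$) onto the upgrade space (the space of the variable $a$) can be written as $$\mathcal F_{R^+} := \mathcal F_{R}\cap\mathcal P .$$ Problem (R$^+$) is equivalent to (P) in the following sense: $a\in\mathcal F_{P}$ if and only if $a\in\mathcal F_{R^+}$. Additionally, (R$^+$) and (P) have the same sets of globally optimal choices of $a$.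
   Context: Data. A power grid has $N$ buses, partitioned into generator buses and load buses. The vector $v\in\mathbb C^N$ collects the bus voltages, $s_{\mathrm{gen}}$ is the complex vector of generator powers, and $s_{\mathrm{load}}$ is the complex vector of load powers, which is given and fixed (a single load snapshot is considered). There are $n_u$ possible upgrades, encoded by $a\in\{0,1\}^{n_u}$, where $a_i=1$ means that upgrade $i$ is performed. The following are given: - a convex cost function $f$ of $a$; - a real matrix $A$ and a real vector $b$ of compatible sizes, describing constraints on upgrade combinations; - for $i\in\{1,\ldots,I\}$, real matrices $Q_i$ of size $2N\times 2N$, real vectors $q_i, m_i$, and lower and upper bounds $\alpha_i,\beta_i$ (the resulting quadratic constraints in (P) below are a reformulation of the power flow equations of the upgraded grid together with its voltage, line current and power limits); - an operating policy $g$, which can be any surjective function $(a,s_{\mathrm{load}})\mapsto g(a,s_{\mathrm{load}})=(s_{\mathrm{gen}},v)$, giving the generator powers and voltages that result from the operator's choices for the given upgrade choice and load vector. Variables. $z=\begin{bmatrix}\operatorname{Re}(v)^T & \operatorname{Im}(v)^T\end{bmatrix}^T\in\mathbb R^{2N}$ contains the voltage variables. The real vector $y$ contains all remaining variables, which include the generator powers $s_{\mathrm{gen}}$ (real and imaginary parts) as well as additional auxiliary variables. Problem (P): $$\min_{a,z,y} f(a)\quad\text{subject to}\quad Aa\le b,\quad a\in\{0,1\}^{n_u},\quad \alpha_i\le z^TQ_iz+q_i^Ty+m_i^Ta\le\beta_i\ \ (i=1,\ldots,I),\quad (s_{\mathrm{gen}},v)=g(a,s_{\mathrm{load}}).$$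 Problem (R) (the mixed-integer semidefinite relaxation of (P), with the policy constraint omitted), with a real symmetric matrix variable $Z\in\mathbb R^{2N\times 2N}$ in place of $zz^T$: $$\min_{a,Z,y} f(a)\quad\text{subject to}\quad Aa\le b,\quad a\in\{0,1\}^{n_u},\quad \alpha_i\le \operatorname{tr}(Q_i^TZ)+q_i^Ty+m_i^Ta\le\beta_i\ \ (i=1,\ldots,I),\quad Z\succeq 0 .$$ Projections of the feasible sets onto the upgrade space: $$\mathcal F_{P}:=\{a\in\{0,1\}^{n_u}\mid Aa\le b,\ \exists (z,y,v,s_{\mathrm{gen}}):\ \alpha_i\le z^TQ_iz+q_i^Ty+m_i^Ta\le\beta_i\ \forall i\in\{1,\ldots,I\},\ (s_{\mathrm{gen}},v)=g(a,s_{\mathrm{load}})\},$$ where $z$ and $y$ are related to $v$ and $s_{\mathrm{gen}}$ as described under "Variables", and $$\mathcal F_{R}:=\{a\in\{0,1\}^{n_u}\mid Aa\le b,\ \exists (Z,y):\ \alpha_i\le \operatorname{tr}(Q_i^TZ)+q_i^Ty+m_i^Ta\le\beta_i\ \forall i\in\{1,\ldots,I\},\ Z\succeq0\}.$$ A globally optimal choice of $a$ for one of these problems is an $a$ in the corresponding projected feasible set that minimizes $f$ over that set. The notation $\|\cdot\|_1$ is the $\ell_1$ norm on $\mathbb R^{n_u}$.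
   Formalization: The claim that P is a convex polyhedron is stated for P intersected with the unit box [0,1]^{n_u}, because P in all of R^{n_u} is not convex whenever A is nonempty (for n_u=1, A={0} it is |a|≥1). *)

theory Defs
  imports "HOL-Analysis.Analysis"
begin

text \<open>
  The buses are indexed by \<open>'g + 'l\<close>: generator buses on the left, load buses on the right.
  Further index types: \<open>'u\<close> upgrades, \<open>'r\<close> rows of the matrix of combination constraints, \<open>'w\<close>
  auxiliary variables. A vector \<open>z\<close> of length \<open>2N\<close> is indexed by two copies of the bus type, real
  parts on the left and imaginary parts on the right. The index of \<open>y\<close> consists of two copies of
  \<open>'g\<close> (real and imaginary parts of the generator powers), followed by \<open>'w\<close>.
\<close>

type_synonym ('g, 'l) bus2 = "('g + 'l) + ('g + 'l)"
type_synonym ('g, 'w) yidx = "('g + 'g) + 'w"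

record ('g, 'l, 'u, 'r, 'w) grid =
  cost :: "real ^ 'u::finite \<Rightarrow> real"
  comb_mat :: "real ^ 'u ^ 'r::finite"
  comb_rhs :: "real ^ 'r"
  num_quad :: nat
  quad_mat :: "nat \<Rightarrow> real ^ ('g::finite, 'l::finite) bus2 ^ ('g, 'l) bus2"
  y_coeff :: "nat \<Rightarrow> real ^ ('g, 'w::finite) yidx"
  a_coeff :: "nat \<Rightarrow> real ^ 'u"
  lower :: "nat \<Rightarrow> real"
  upper :: "nat \<Rightarrow> real"
  policy :: "(real ^ 'u) \<times> (complex ^ 'l) \<Rightarrow> (complex ^ 'g) \<times> (complex ^ ('g + 'l))"
  load :: "complex ^ 'l"

definition binary_vecs :: "(real ^ 'u) set" where
  "binary_vecs = {a. \<forall>i. a $ i \<in> {0, 1}}"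

definition l1_norm :: "real ^ 'u \<Rightarrow> real" where
  "l1_norm a = (\<Sum>i\<in>UNIV. \<bar>a $ i\<bar>)"

definition re_im :: "complex ^ 'k \<Rightarrow> real ^ ('k + 'k)" where
  "re_im v = (\<chi> k. case k of Inl j \<Rightarrow> Re (v $ j) | Inr j \<Rightarrow> Im (v $ j))"

definition psd :: "real ^ 'k ^ 'k \<Rightarrow> bool" where
  "psd Z \<longleftrightarrow> transpose Z = Z \<and> (\<forall>x. 0 \<le> x \<bullet> (Z *v x))"

definition feas_P ::
  "('g::finite, 'l::finite, 'u::finite, 'r::finite, 'w::finite) grid
    \<Rightarrow> ((real ^ 'u) \<times> (real ^ ('g, 'l) bus2) \<times> (real ^ ('g, 'w) yidx)) set" where
  "feas_P D = {(a, z, y).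
     comb_mat D *v a \<le> comb_rhs D \<and> a \<in> binary_vecs \<and>
     (\<forall>i\<in>{1..num_quad D}.
        lower D i \<le> z \<bullet> (quad_mat D i *v z) + y_coeff D i \<bullet> y + a_coeff D i \<bullet> a \<and>
        z \<bullet> (quad_mat D i *v z) + y_coeff D i \<bullet> y + a_coeff D i \<bullet> a \<le> upper D i) \<and>
     (\<exists>v s_gen. z = re_im v \<and> (\<forall>k. y $ Inl k = re_im s_gen $ k) \<and>
        (s_gen, v) = policy D (a, load D))}"

definition feas_R ::
  "('g::finite, 'l::finite, 'u::finite, 'r::finite, 'w::finite) grid
    \<Rightarrow> ((real ^ 'u) \<times> (real ^ ('g, 'l) bus2 ^ ('g, 'l) bus2) \<times> (real ^ ('g, 'w) yidx)) set" where
  "feas_R D = {(a, Z, y).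
     comb_mat D *v a \<le> comb_rhs D \<and> a \<in> binary_vecs \<and>
     (\<forall>i\<in>{1..num_quad D}.
        lower D i \<le> trace (transpose (quad_mat D i) ** Z) + y_coeff D i \<bullet> y + a_coeff D i \<bullet> a \<and>
        trace (transpose (quad_mat D i) ** Z) + y_coeff D i \<bullet> y + a_coeff D i \<bullet> a \<le> upper D i) \<and>
     psd Z}"

definition F_P ::
  "('g::finite, 'l::finite, 'u::finite, 'r::finite, 'w::finite) grid \<Rightarrow> (real ^ 'u) set" where
  "F_P D = fst ` feas_P D"

definition F_R ::
  "('g::finite, 'l::finite, 'u::finite, 'r::finite, 'w::finite) grid \<Rightarrow> (real ^ 'u) set" where
  "F_R D = fst ` feas_R D"

definition cut_points ::
  "('g::finite, 'l::finite, 'u::finite, 'r::finite, 'w::finite) grid \<Rightarrow> (real ^ 'u) set" where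
  "cut_points D = {a \<in> binary_vecs. a \<in> F_R D - F_P D}"

text \<open>
  The constraint \<open>l1_norm (a - r) \<ge> 1\<close> is affine in \<open>a\<close> on the unit box, because \<open>r\<close> is binary;
  on the whole space it cuts out the complement of an open cross-polytope, so \<open>cut_region\<close> is
  polyhedral, and convex, only relative to the box.
\<close>

definition cut_region ::
  "('g::finite, 'l::finite, 'u::finite, 'r::finite, 'w::finite) grid \<Rightarrow> (real ^ 'u) set" where
  "cut_region D = {a. \<forall>r\<in>cut_points D. l1_norm (a - r) \<ge> 1}"

definition feas_Rplus ::
  "('g::finite, 'l::finite, 'u::finite, 'r::finite, 'w::finite) grid
    \<Rightarrow> ((real ^ 'u) \<times> (real ^ ('g, 'l) bus2 ^ ('g, 'l) bus2) \<times> (real ^ ('g, 'w) yidx)) set" where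
  "feas_Rplus D = {(a, Z, y).
     (a, Z, y) \<in> feas_R D \<and> (\<forall>r\<in>cut_points D. l1_norm (a - r) \<ge> 1)}"

definition F_Rplus ::
  "('g::finite, 'l::finite, 'u::finite, 'r::finite, 'w::finite) grid \<Rightarrow> (real ^ 'u) set" where
  "F_Rplus D = F_R D \<inter> cut_region D"

definition optimal_choices :: "('a \<Rightarrow> real) \<Rightarrow> 'a set \<Rightarrow> 'a set" where
  "optimal_choices f F = {a \<in> F. \<forall>a'\<in>F. f a \<le> f a'}"

end

theory Submission
  imports Defs
begin

text \<open>
  Substituting \<open>Z = z z\<^sup>T\<close> shows \<open>F_P \<subseteq> F_R\<close>. Distinct binary vectors have \<open>\<ell>\<^sub>1\<close> distance at least 1, so
  the cuts remove from \<open>F_R\<close> exactly the points outside \<open>F_P\<close>. On the unit box the distance to a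
  binary vector is affine, so each of the finitely many cuts is a half-space there.
\<close>

text \<open>Binary vectors are the indicators of subsets of the finite index type. This bounds the
  number of cuts, since a polyhedron allows only finitely many half-spaces.\<close>

lemma finite_binary_vecs: "finite (binary_vecs :: (real ^ 'u::finite) set)"
proof (rule finite_subset)
  show "binary_vecs \<subseteq> range (\<lambda>S. \<chi> i::'u. if i \<in> S then 1 else (0::real))"
  proof
    fix a :: "real ^ 'u" assume "a \<in> binary_vecs"
    then have "a = (\<chi> i. if i \<in> {i. a $ i = 1} then 1 else 0)"
      by (auto simp: vec_eq_iff binary_vecs_def)
    then show "a \<in> range (\<lambda>S. \<chi> i. if i \<in> S then 1 else 0)"
      by blast
  qed
qed simp

lemma l1_norm_diff_binary_ge_1:
  assumes "a \<in> binary_vecs" "r \<in> binary_vecs" "a \<noteq> r"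
  shows "1 \<le> l1_norm (a - r)"
proof -
  obtain i where i: "a $ i \<noteq> r $ i"
    using assms(3) by (auto simp: vec_eq_iff)
  have "a $ i \<in> {0, 1}" "r $ i \<in> {0, 1}"
    using assms by (auto simp: binary_vecs_def)
  then have "1 = \<bar>(a - r) $ i\<bar>"
    using i by auto
  also have "\<dots> \<le> l1_norm (a - r)"
    unfolding l1_norm_def by (rule member_le_sum) auto
  finally show ?thesis .
qed

text \<open>For t in [0, 1], the distance to 0 is t and the distance to 1 is 1 - t; the single
  formula s + (1 - 2 * s) * t covers both values s = 0 and s = 1.\<close>

lemma l1_norm_diff_binary_eq_affine:
  assumes "r \<in> binary_vecs" "\<forall>i. 0 \<le> a $ i \<and> a $ i \<le> 1"
  shows "l1_norm (a - r) = (\<Sum>i\<in>UNIV. r $ i) + (\<chi> i. 1 - 2 * r $ i) \<bullet> a"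
proof -
  have "\<bar>(a - r) $ i\<bar> = r $ i + (1 - 2 * r $ i) * a $ i" for i
    using assms(1) assms(2)[rule_format, of i] by (auto simp: binary_vecs_def dest: spec[of _ i])
  then show ?thesis
    by (simp add: l1_norm_def inner_vec_def sum.distrib)
qed

lemma polyhedron_cut_region_Int_box:
  fixes D :: "('g::finite, 'l::finite, 'u::finite, 'r::finite, 'w::finite) grid"
  shows "polyhedron (cut_region D \<inter> {a. \<forall>i. 0 \<le> a $ i \<and> a $ i \<le> 1})"
proof -
  \<comment> \<open>The half-space \<open>H r\<close> agrees with the cut at \<open>r\<close> on the
    unit box; outside the box the two may differ.\<close>
  define H :: "real ^ 'u \<Rightarrow> (real ^ 'u) set"
    where "H r = {a. (\<chi> i. 1 - 2 * r $ i) \<bullet> a \<ge> 1 - (\<Sum>i\<in>UNIV. r $ i)}" for r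
  have binary: "cut_points D \<subseteq> binary_vecs"
    by (auto simp: cut_points_def)
  have "a \<in> H r \<longleftrightarrow> 1 \<le> l1_norm (a - r)"
    if "r \<in> cut_points D" "\<forall>i. 0 \<le> a $ i \<and> a $ i \<le> 1" for r a
    using that binary by (auto simp: H_def l1_norm_diff_binary_eq_affine)
  then have eq: "cut_region D \<inter> {a. \<forall>i. 0 \<le> a $ i \<and> a $ i \<le> 1} = \<Inter> (H ` cut_points D) \<inter> cbox 0 1"
    by (auto simp: cut_region_def mem_box_cart)
  have "finite (cut_points D)"
    using binary finite_binary_vecs by (rule finite_subset)
  then have "polyhedron (\<Inter> (H ` cut_points D))"
    by (intro polyhedron_Inter) (auto simp: H_def intro: polyhedron_halfspace_ge)
  moreover have "polyhedron (cbox 0 1 :: (real ^ 'u) set)"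
    by (intro polytope_imp_polyhedron polytope_interval)
  ultimately show ?thesis
    unfolding eq by (rule polyhedron_Int)
qed

lemma trace_transpose_mult_outer:
  fixes Q :: "real ^ 'k::finite ^ 'k"
  shows "trace (transpose Q ** (\<chi> i j. z $ i * z $ j)) = z \<bullet> (Q *v z)"
proof -
  have "trace (transpose Q ** (\<chi> i j. z $ i * z $ j)) = (\<Sum>j\<in>UNIV. \<Sum>i\<in>UNIV. Q $ i $ j * (z $ i * z $ j))"
    by (simp add: trace_def matrix_matrix_mult_def transpose_def)
  also have "\<dots> = (\<Sum>i\<in>UNIV. \<Sum>j\<in>UNIV. Q $ i $ j * (z $ i * z $ j))"
    by (rule sum.swap)
  also have "\<dots> = z \<bullet> (Q *v z)"
    by (simp add: inner_vec_def matrix_vector_mult_def sum_distrib_left ac_simps)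
  finally show ?thesis .
qed

text \<open>The quadratic form of a rank-one matrix is the square of a linear form.\<close>

lemma psd_outer: "psd (\<chi> i j. z $ i * z $ j :: real ^ 'k::finite ^ 'k)"
proof -
  have "x \<bullet> ((\<chi> i j. z $ i * z $ j) *v x) = (z \<bullet> x)\<^sup>2" for x
    by (simp add: inner_vec_def matrix_vector_mult_def power2_eq_square sum_product
        sum_distrib_left ac_simps)
  then show ?thesis
    by (simp add: psd_def transpose_def vec_eq_iff mult.commute)
qed

lemma F_P_subset_F_R: "F_P D \<subseteq> F_R D"
proof
  fix a assume "a \<in> F_P D"
  then obtain z y where "(a, z, y) \<in> feas_P D"
    by (auto simp: F_P_def)
  \<comment> \<open>The rank-one lift leaves every quadratic constraint value unchanged, so the same
    \<open>y\<close> serves as witness.\<close>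
  then have "(a, \<chi> i j. z $ i * z $ j, y) \<in> feas_R D"
    by (simp add: feas_P_def feas_R_def trace_transpose_mult_outer psd_outer)
  then show "a \<in> F_R D"
    unfolding F_R_def by force
qed

lemma F_R_subset_binary_vecs: "F_R D \<subseteq> binary_vecs"
  by (auto simp: F_R_def feas_R_def)

text \<open>The cuts constrain \<open>a\<close> alone, so imposing them commutes with projecting out
  \<open>Z\<close> and \<open>y\<close>.\<close>

lemma fst_feas_Rplus: "fst ` feas_Rplus D = F_Rplus D"
  by (force simp: feas_Rplus_def F_Rplus_def F_R_def cut_region_def)

lemma F_Rplus_eq_F_P: "F_Rplus D = F_P D"
proof
  show "F_Rplus D \<subseteq> F_P D"
  proof
    fix a assume a: "a \<in> F_Rplus D"
    \<comment> \<open>A cut point has distance 0 from itself and so violates its own cut.\<close>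
    have "a \<notin> cut_points D"
      using a by (force simp: F_Rplus_def cut_region_def l1_norm_def)
    then show "a \<in> F_P D"
      using a F_R_subset_binary_vecs[of D] by (auto simp: F_Rplus_def cut_points_def)
  qed
  show "F_P D \<subseteq> F_Rplus D"
  proof
    fix a assume a: "a \<in> F_P D"
    then have "a \<in> F_R D" "a \<in> binary_vecs"
      using F_P_subset_F_R[of D] F_R_subset_binary_vecs[of D] by auto
    \<comment> \<open>Here \<open>a\<close> differs from \<open>r\<close>, because \<open>a\<close>
      lies in \<open>F_P D\<close> and cut points do not.\<close>
    moreover have "1 \<le> l1_norm (a - r)" if "r \<in> cut_points D" for r
      using that a \<open>a \<in> binary_vecs\<close>
      by (intro l1_norm_diff_binary_ge_1) (auto simp: cut_points_def)
    ultimately show "a \<in> F_Rplus D"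
      by (simp add: F_Rplus_def cut_region_def)
  qed
qed

theorem theorem1:
  fixes D :: "('g::finite, 'l::finite, 'u::finite, 'r::finite, 'w::finite) grid"
  assumes cost_convex: "convex_on UNIV (cost D)"
    and policy_surj: "policy D ` (binary_vecs \<times> UNIV) = UNIV"
  shows "polyhedron (cut_region D \<inter> {a. \<forall>i. 0 \<le> a $ i \<and> a $ i \<le> 1}) \<and>
    fst ` feas_Rplus D = F_Rplus D \<and>
    (\<forall>a. a \<in> F_P D \<longleftrightarrow> a \<in> F_Rplus D) \<and>
    optimal_choices (cost D) (fst ` feas_Rplus D) = optimal_choices (cost D) (F_P D)"
  \<comment> \<open>Both problems minimize the same cost over the same set of choices, so their
    minimizers coincide.\<close>
  by (simp add: polyhedron_cut_region_Int_box fst_feas_Rplus F_Rplus_eq_F_P)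

end
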